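(* In the setting described in the context, in particular assuming that $A$ has a unique dominant mode $k_\star$, there is a neighborhood of $(\boldsymbol v,\mu,\boldsymbol b)=(\boldsymbol 0,0,\boldsymbol 0)$ in $E_c\times\mathbb R\times\mathbb R^K$ on which the reduced map $\mathcal G$ satisfies $$\mathcal{G}(\boldsymbol v,\mu,\boldsymbol b)= \mu \boldsymbol v + \Psi_A(\boldsymbol b)+ \frac{s_3}{6}\alpha_c^3\,\Psi_A\big((A\boldsymbol v)^{\circ 3}\big)+ \frac{s_3}{2}\alpha_c^2\,\Psi_A\big((A\boldsymbol v)^{\circ 2} \circ \boldsymbol b\big)+ \mathcal{R},$$ where $$\mathcal{R}=\mathcal{O}(\|\boldsymbol v\|^5)+\mathcal{O}(|\mu|\|\boldsymbol v\|^3)+\mathcal{O}(\|\boldsymbol b\|\|\boldsymbol v\|^2)+\mathcal{O}(\|\boldsymbol b\|^2\|\boldsymbol v\|)+\mathcal{O}(\|\boldsymbol b\|^3).$$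
   Context: Let $K$ be a positive integer and $\theta_j=2\pi j/K$, $j=0,\dots,K-1$. Let $A\in\mathbb R^{K\times K}$ be real, symmetric and circulant. On $\mathbb R^K$ use $\langle \boldsymbol u,\boldsymbol v\rangle=\frac1K\sum_j u_jv_j$. Let $\boldsymbol\phi_k=(\cos(k\theta_j))_{j}$, $\boldsymbol\psi_k=(\sin(k\theta_j))_{j}$, $k=0,\dots,\lfloor K/2\rfloor$; these satisfy $A\boldsymbol\phi_k=\lambda_k\boldsymbol\phi_k$, $A\boldsymbol\psi_k=\lambda_k\boldsymbol\psi_k$ with $\lambda_k$ real. Unique dominant mode: there is a unique index $k_\star$ with $\lambda_{k_\star}>\lambda_k$ for all $k\ne k_\star$ in $\{0,\dots,\lfloor K/2\rfloor\}$; moreover $\lambda_{k_\star}>0$ and $0<k_\star<K/2$, so that $E_c=\mathrm{span}\{\boldsymbol\phi_{k_\star},\boldsymbol\psi_{k_\star}\}$ is two-dimensional. Let $E_s=E_c^\perp$, let $\Psi_A$ be the orthogonal projection onto $E_c$ and $\Psi_A^\perp=I-\Psi_A$ the orthogonal projection onto $E_s$. Let $d_z>0$ and let $S:\mathbb R\to\mathbb R$ be odd, $\mathcal C^3$ and sigmoidal with $S'(0)=1$ and $s_3:=S'''(0)\ne0$; $S$ acts componentwise on vectors. For $\alpha>0$ and $\boldsymbol b\in\mathbb R^K$ define $F(\boldsymbol z,\alpha,\boldsymbol b)=-d_z\boldsymbol z+S(\alpha A\boldsymbol z+\boldsymbol b)$. Put $\alpha_c=d_z/\lambda_{k_\star}$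 and $\mu=-d_z+\alpha\lambda_{k_\star}$ (so $\alpha=\alpha_c+\mu/\lambda_{k_\star}$). Lyapunov–Schmidt reduction: write $\boldsymbol z=\boldsymbol v+\boldsymbol w$, $\boldsymbol v\in E_c$, $\boldsymbol w\in E_s$. By the implicit function theorem, near $(\boldsymbol 0,\alpha_c,\boldsymbol 0)$ there is a unique $\mathcal C^3$ map $W(\boldsymbol v,\alpha,\boldsymbol b)\in E_s$ with $W(\boldsymbol 0,\alpha_c,\boldsymbol 0)=\boldsymbol 0$ and $\Psi_A^\perp F(\boldsymbol v+W(\boldsymbol v,\alpha,\boldsymbol b),\alpha,\boldsymbol b)=\boldsymbol 0$. The reduced map is $\mathcal G(\boldsymbol v,\mu,\boldsymbol b)=\Psi_AF(\boldsymbol v+W(\boldsymbol v,\alpha,\boldsymbol b),\alpha,\boldsymbol b)$ with $\alpha=\alpha_c+\mu/\lambda_{k_\star}$. $\circ$ denotes the entrywise (Hadamard) product and $\boldsymbol x^{\circ n}$ the entrywise $n$-th power. The $\mathcal O$ terms are understood as $(\boldsymbol v,\mu,\boldsymbol b)\to(\boldsymbol 0,0,\boldsymbol 0)$.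
   Formalization: S is additionally assumed to be C^5 near 0; with S only C^3 the O(‖v‖^5) bound fails, e.g. for S(x) = x + (s_3/6)x^3 + sgn(x)|x|^{7/2} near 0 with b = 0 and μ = 0. *)

theory Defs
  imports "HOL-Analysis.Analysis"
begin

text \<open>
  Vectors of length \<open>K\<close> are elements of \<open>real ^ 'n\<close> with \<open>K = CARD('n)\<close>; a bijection
  \<open>idx\<close> from \<open>'n\<close> to \<open>{..<K}\<close> provides the labels \<open>0, ..., K - 1\<close>.  On this type the library
  operations \<open>*\<close> and \<open>^\<close> act componentwise, so they are the Hadamard product and the
  Hadamard power.
\<close>

definition angle :: "('n::finite \<Rightarrow> nat) \<Rightarrow> 'n \<Rightarrow> real"
  where "angle idx j = 2 * pi * real (idx j) / real CARD('n)"

definition cos_mode :: "('n::finite \<Rightarrow> nat) \<Rightarrow> nat \<Rightarrow> real ^ 'n"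
  where "cos_mode idx k = (\<chi> j. cos (real k * angle idx j))"

definition sin_mode :: "('n::finite \<Rightarrow> nat) \<Rightarrow> nat \<Rightarrow> real ^ 'n"
  where "sin_mode idx k = (\<chi> j. sin (real k * angle idx j))"

definition circulant :: "('n::finite \<Rightarrow> nat) \<Rightarrow> real ^ 'n ^ 'n \<Rightarrow> bool"
  where "circulant idx A \<longleftrightarrow>
    (\<exists>c :: int \<Rightarrow> real. \<forall>i j. A $ i $ j = c ((int (idx j) - int (idx i)) mod int CARD('n)))"

text \<open>
  For a symmetric circulant matrix the two modes of frequency \<open>k\<close> share one real eigenvalue.
  It is unique because \<open>cos_mode idx k\<close> never vanishes (its entry with label 0 is 1).
\<close>

definition mode_eigenvalue :: "('n::finite \<Rightarrow> nat) \<Rightarrow> real ^ 'n ^ 'n \<Rightarrow> nat \<Rightarrow> real"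
  where "mode_eigenvalue idx A k =
    (THE l. A *v cos_mode idx k = l *\<^sub>R cos_mode idx k \<and>
            A *v sin_mode idx k = l *\<^sub>R sin_mode idx k)"

definition dominant_mode :: "('n::finite \<Rightarrow> nat) \<Rightarrow> real ^ 'n ^ 'n \<Rightarrow> nat \<Rightarrow> bool"
  where "dominant_mode idx A m \<longleftrightarrow>
    0 < m \<and> 2 * m < CARD('n) \<and> mode_eigenvalue idx A m > 0 \<and>
    (\<forall>k \<le> CARD('n) div 2. k \<noteq> m \<longrightarrow> mode_eigenvalue idx A m > mode_eigenvalue idx A k)"

definition mode_space :: "('n::finite \<Rightarrow> nat) \<Rightarrow> nat \<Rightarrow> (real ^ 'n) set"
  where "mode_space idx k = span {cos_mode idx k, sin_mode idx k}"

definition avg_inner :: "real ^ 'n \<Rightarrow> real ^ 'n \<Rightarrow> real"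
  where "avg_inner u v = (\<Sum>j\<in>UNIV. u $ j * v $ j) / real CARD('n)"

definition avg_orth :: "(real ^ 'n) set \<Rightarrow> (real ^ 'n) set"
  where "avg_orth E = {w. \<forall>v\<in>E. avg_inner w v = 0}"

definition orth_proj :: "(real ^ 'n) set \<Rightarrow> real ^ 'n \<Rightarrow> real ^ 'n"
  where "orth_proj E u = (THE v. v \<in> E \<and> u - v \<in> avg_orth E)"

text \<open>
  For open \<open>T\<close> in a finite-dimensional space and any \<open>n\<close>, \<open>Ck_on n T f\<close> says that \<open>f\<close> is of
  class \<open>C^n\<close> on \<open>T\<close>: all iterated directional derivatives up to order \<open>n\<close> are continuous.
\<close>

fun Ck_on :: "nat \<Rightarrow> 'a set \<Rightarrow> ('a::real_normed_vector \<Rightarrow> 'b::real_normed_vector) \<Rightarrow> bool"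
  where
    "Ck_on 0 T f \<longleftrightarrow> continuous_on T f"
  | "Ck_on (Suc n) T f \<longleftrightarrow>
       (\<forall>x\<in>T. f differentiable (at x)) \<and>
       (\<forall>h. Ck_on n T (\<lambda>x. frechet_derivative f (at x) h))"

text \<open>
  Definitions of a sigmoidal function vary; monotonicity and boundedness are their common core.
\<close>

definition sigmoidal :: "(real \<Rightarrow> real) \<Rightarrow> bool"
  where "sigmoidal S \<longleftrightarrow> mono S \<and> bounded (range S)"

definition field_map ::
    "real \<Rightarrow> (real \<Rightarrow> real) \<Rightarrow> real ^ 'n ^ 'n \<Rightarrow> real ^ 'n \<Rightarrow> real \<Rightarrow> real ^ 'n \<Rightarrow> real ^ 'n"
  where "field_map d S A z \<alpha> b = - (d *\<^sub>R z) + (\<chi> j. S ((\<alpha> *\<^sub>R (A *v z) + b) $ j))"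

text \<open>
  \<open>W\<close> solves the complementary equation on the part of the open set \<open>U\<close> where the first
  component lies in \<open>E\<close>.  A map on a relatively open subset of \<open>E \<times> \<real> \<times> \<real>^K\<close> is of class \<open>C^3\<close>
  iff its composition with the linear projection onto \<open>E\<close> in the first component is so on the
  (open) preimage; values of \<open>W\<close> off \<open>E\<close> are irrelevant.
\<close>

definition lyapunov_schmidt_map ::
    "(real ^ 'n) set \<Rightarrow> (real ^ 'n \<Rightarrow> real \<Rightarrow> real ^ 'n \<Rightarrow> real ^ 'n) \<Rightarrow> real \<Rightarrow>
     ((real ^ 'n) \<times> real \<times> (real ^ 'n)) set \<Rightarrow> (real ^ 'n \<Rightarrow> real \<Rightarrow> real ^ 'n \<Rightarrow> real ^ 'n) \<Rightarrow> bool"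
  where "lyapunov_schmidt_map E F \<alpha>c U W \<longleftrightarrow>
    open U \<and> (0, \<alpha>c, 0) \<in> U \<and> W 0 \<alpha>c 0 = 0 \<and>
    Ck_on 3 {(v, \<alpha>, b). (orth_proj E v, \<alpha>, b) \<in> U} (\<lambda>(v, \<alpha>, b). W (orth_proj E v) \<alpha> b) \<and>
    (\<forall>v \<alpha> b. (v, \<alpha>, b) \<in> U \<longrightarrow> v \<in> E \<longrightarrow>
       W v \<alpha> b \<in> avg_orth E \<and>
       F (v + W v \<alpha> b) \<alpha> b - orth_proj E (F (v + W v \<alpha> b) \<alpha> b) = 0)"

definition reduced_map ::
    "(real ^ 'n) set \<Rightarrow> (real ^ 'n \<Rightarrow> real \<Rightarrow> real ^ 'n \<Rightarrow> real ^ 'n) \<Rightarrow> real \<Rightarrow> real \<Rightarrow>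
     (real ^ 'n \<Rightarrow> real \<Rightarrow> real ^ 'n \<Rightarrow> real ^ 'n) \<Rightarrow> real ^ 'n \<Rightarrow> real \<Rightarrow> real ^ 'n \<Rightarrow> real ^ 'n"
  where "reduced_map E F \<alpha>c l W v \<mu> b =
    orth_proj E (F (v + W v (\<alpha>c + \<mu> / l) b) (\<alpha>c + \<mu> / l) b)"

end

theory Submission
  imports Defs
begin

text \<open>
  Only the size of \<open>w = W(v, \<alpha>, b)\<close> matters.  Write \<open>S x = x + (s\<^sub>3/6) x\<^sup>3 + r(x)\<close>; since \<open>S\<close> is odd
  and \<open>C\<^sup>5\<close> near 0, \<open>r(x) = O(\<bar>x\<bar>\<^sup>5)\<close>.  The Fourier modes are complete, so \<open>d - \<alpha>\<^sub>c A\<close> is injective on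
  the orthogonal complement of \<open>E\<close>; the complementary equation together with continuity of \<open>W\<close>
  at the base point then gives \<open>w = O(\<parallel>v\<parallel>\<^sup>3 + \<parallel>b\<parallel>)\<close>.  Inserting \<open>x = \<alpha> A v + q\<close> with
  \<open>q = \<alpha> A w + b\<close> into the cubic term of the projected equation leaves a remainder bounded by
  the sum of the five weights; it is distributed among \<open>R1, ..., R5\<close> in proportion to them.
\<close>

section \<open>Taylor expansion of odd functions\<close>

text \<open>On an open set, equal values force equal derivatives at every point, so the induction on
  the order can pass to directional derivatives. It serves to exchange
  \<open>frechet_derivative\<close> in direction 1 for \<open>deriv\<close>.\<close>

lemma Ck_on_cong_open:
  assumes "open T" "\<And>x. x \<in> T \<Longrightarrow> f x = g x" "Ck_on n T f"
  shows "Ck_on n T g"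
  using assms(2,3)
proof (induction n arbitrary: f g)
  case 0
  then show ?case using continuous_on_cong by (metis Ck_on.simps(1))
next
  case (Suc n)
  have eq: "(g has_derivative D) (at x)" if "x \<in> T" "(f has_derivative D) (at x)" for x D
    using has_derivative_transform_within_open[OF that(2) \<open>open T\<close> that(1)] Suc.prems(1) by blast
  have fd: "frechet_derivative f (at x) = frechet_derivative g (at x)" if "x \<in> T" for x
    using eq[OF that] Suc.prems(2) that
    by (metis Ck_on.simps(2) frechet_derivative_at frechet_derivative_works)
  have "g differentiable (at x)" if "x \<in> T" for x
    using eq[OF that] Suc.prems(2) that unfolding differentiable_def
    by (metis Ck_on.simps(2) differentiable_def)
  moreover have "Ck_on n T (\<lambda>x. frechet_derivative g (at x) h)" for h
    by (rule Suc.IH[of "\<lambda>x. frechet_derivative f (at x) h"]) (use fd Suc.prems(2) in auto)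
  ultimately show ?case by simp
qed

lemma Ck_on_Suc_deriv:
  fixes f :: "real \<Rightarrow> real"
  assumes "open T" "Ck_on (Suc n) T f"
  shows "x \<in> T \<Longrightarrow> (f has_real_derivative deriv f x) (at x)"
    and "Ck_on n T (deriv f)"
proof -
  have d: "(f has_real_derivative deriv f x) (at x)" if "x \<in> T" for x
    using assms that by (simp add: DERIV_deriv_iff_real_differentiable)
  have Ck: "Ck_on n T (\<lambda>x. frechet_derivative f (at x) 1)" using assms by simp
  have eq: "frechet_derivative f (at x) 1 = deriv f x" if "x \<in> T" for x
    using frechet_derivative_at[OF d[OF that, unfolded has_field_derivative_def]]
    by (metis mult.right_neutral)
  show "Ck_on n T (deriv f)"
    by (rule Ck_on_cong_open[OF assms(1) eq Ck])
  show "x \<in> T \<Longrightarrow> (f has_real_derivative deriv f x) (at x)" by (rule d)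
qed

lemma Ck_on_deriv_funpow:
  fixes f :: "real \<Rightarrow> real"
  assumes "open T" "Ck_on n T f" "k \<le> n"
  shows "Ck_on (n - k) T ((deriv ^^ k) f)"
  using assms(3)
proof (induction k)
  case 0
  then show ?case using assms by simp
next
  case (Suc k)
  then have "Ck_on (Suc (n - Suc k)) T ((deriv ^^ k) f)"
    by (simp add: Suc_diff_Suc del: Ck_on.simps)
  from Ck_on_Suc_deriv(2)[OF assms(1) this] show ?case by simp
qed

text \<open>M bounds the continuous fifth derivative on the compact interval of half the radius,
  which is why the estimate stops at \<open>\<delta> / 2\<close>; the factor 1/5! of the Lagrange
  remainder is discarded.\<close>

lemma odd_C5_expansion:
  fixes S :: "real \<Rightarrow> real"
  assumes odd: "\<And>x. S (- x) = - S x" and "\<delta> > 0" and C5: "Ck_on 5 {- \<delta> <..< \<delta>} S"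
  shows "\<exists>M\<ge>0. \<forall>x. \<bar>x\<bar> \<le> \<delta> / 2 \<longrightarrow>
    \<bar>S x - (deriv S 0 * x + (deriv ^^ 3) S 0 / 6 * x ^ 3)\<bar> \<le> M * \<bar>x\<bar> ^ 5"
proof -
  let ?I = "{- \<delta> <..< \<delta>}"
  define f where "f i = (deriv ^^ i) S" for i
  have Ck: "Ck_on (5 - k) ?I (f k)" if "k \<le> 5" for k
    unfolding f_def using Ck_on_deriv_funpow[OF _ C5 that] by simp
  have der: "(f k has_real_derivative f (Suc k) x) (at x)" if "k < 5" "x \<in> ?I" for k x
  proof -
    have "5 - k = Suc (5 - Suc k)" using that by simp
    then have "Ck_on (Suc (5 - Suc k)) ?I (f k)" using Ck[of k] that(1) by (simp del: Ck_on.simps)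
    from Ck_on_Suc_deriv(1)[OF _ this that(2)] show ?thesis by (simp add: f_def)
  qed
  have "continuous_on ?I (f 5)" using Ck[of 5] by simp
  then have "continuous_on {- \<delta> / 2 .. \<delta> / 2} (f 5)"
    by (rule continuous_on_subset) (use \<open>\<delta> > 0\<close> in auto)
  then have "bounded (f 5 ` {- \<delta> / 2 .. \<delta> / 2})"
    by (intro compact_imp_bounded compact_continuous_image) auto
  then obtain M where "\<forall>t\<in>{- \<delta> / 2 .. \<delta> / 2}. \<bar>f 5 t\<bar> \<le> M"
    by (auto simp: bounded_iff)
  then have M: "\<bar>f 5 t\<bar> \<le> M" if "t \<in> {- \<delta> / 2 .. \<delta> / 2}" for t
    using that by blast
  have M0: "M \<ge> 0" using M[of 0] \<open>\<delta> > 0\<close> by auto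
  define T where "T x = (\<Sum>k<5. f k 0 / fact k * x ^ k)" for x
  have taylor: "\<bar>S x - T x\<bar> \<le> M * \<bar>x\<bar> ^ 5" if "\<bar>x\<bar> \<le> \<delta> / 2" for x
  proof -
    have "\<exists>t. \<bar>t\<bar> \<le> \<bar>x\<bar> \<and> S x = T x + f 5 t / fact 5 * x ^ 5"
      unfolding T_def
    proof (rule Maclaurin_bi_le)
      show "\<forall>k t. k < 5 \<and> \<bar>t\<bar> \<le> \<bar>x\<bar> \<longrightarrow> (f k has_real_derivative f (Suc k) t) (at t)"
        using that \<open>\<delta> > 0\<close> by (intro allI impI der) auto
    qed (simp add: f_def)
    then obtain t where t: "\<bar>t\<bar> \<le> \<bar>x\<bar>" "S x = T x + f 5 t / fact 5 * x ^ 5" by blast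
    have "\<bar>f 5 t\<bar> \<le> M" using t that by (intro M) auto
    then have "\<bar>f 5 t / fact 5\<bar> \<le> M" using M0 by (simp add: fact_numeral)
    then have "\<bar>f 5 t / fact 5\<bar> * \<bar>x\<bar> ^ 5 \<le> M * \<bar>x\<bar> ^ 5"
      by (rule mult_right_mono) simp
    then show ?thesis
      using t(2) by (simp add: abs_mult power_abs)
  qed
  have "\<bar>S x - (deriv S 0 * x + (deriv ^^ 3) S 0 / 6 * x ^ 3)\<bar> \<le> M * \<bar>x\<bar> ^ 5"
    if x: "\<bar>x\<bar> \<le> \<delta> / 2" for x
  proof -
    \<comment> \<open>passing to the odd part removes the even Taylor coefficients\<close>
    define p where "p = deriv S 0 * x + (deriv ^^ 3) S 0 / 6 * x ^ 3"
    have "T x - T (- x) = 2 * p"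
      by (simp add: T_def f_def p_def eval_nat_numeral)
    then have "2 * (S x - p) = (S x - T x) - (S (- x) - T (- x))"
      using odd[of x] by argo
    moreover have "\<bar>S (- x) - T (- x)\<bar> \<le> M * \<bar>x\<bar> ^ 5"
      using taylor[of "- x"] x by simp
    ultimately have "\<bar>S x - p\<bar> \<le> M * \<bar>x\<bar> ^ 5"
      using taylor[OF x] unfolding abs_le_iff by argo
    then show ?thesis by (simp only: p_def)
  qed
  with M0 show ?thesis by blast
qed

section \<open>Orthogonal projections\<close>

lemma avg_inner_eq: "avg_inner u v = (u \<bullet> v) / real CARD('n)" for u v :: "real ^ 'n"
  by (simp add: avg_inner_def inner_vec_def)

text \<open>The factor 1/K does not affect orthogonality, so the library inner product can be used
  from here on.\<close>

lemma avg_orth_iff: "w \<in> avg_orth E \<longleftrightarrow> (\<forall>v\<in>E. w \<bullet> v = 0)"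
  by (auto simp: avg_orth_def avg_inner_eq)

lemma subspace_avg_orth: "subspace (avg_orth E)"
  by (auto simp: subspace_def avg_orth_iff inner_add_left)

context
  fixes E :: "(real ^ 'n) set"
  assumes E: "subspace E"
begin

text \<open>The difference of two candidates lies both in E and in its complement, so it is
  orthogonal to itself. This justifies the description operator and is the way every projection
  below is computed.\<close>

lemma orth_proj_unique:
  assumes "v \<in> E" "u - v \<in> avg_orth E"
  shows "orth_proj E u = v"
  unfolding orth_proj_def
proof (rule the_equality)
  fix v' assume v': "v' \<in> E \<and> u - v' \<in> avg_orth E"
  have "v - v' \<in> E" using assms v' E subspace_diff by blast
  moreover have "v - v' \<in> avg_orth E"
    using subspace_diff[OF subspace_avg_orth, of "u - v'" E "u - v"] v' assms by simp
  ultimately show "v' = v" by (auto simp: avg_orth_iff)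
qed (use assms in auto)

lemma orth_proj_mem: "orth_proj E u \<in> E"
  and orth_proj_compl: "u - orth_proj E u \<in> avg_orth E"
proof -
  obtain y z where yz: "y \<in> span E" "\<And>w. w \<in> span E \<Longrightarrow> orthogonal z w" "u = y + z"
    using orthogonal_subspace_decomp_exists[of E u] by metis
  have sp: "span E = E" using E by simp
  then have "y \<in> E" "u - y \<in> avg_orth E"
    using yz sp by (simp_all add: avg_orth_iff orthogonal_def)
  with orth_proj_unique[OF this] show "orth_proj E u \<in> E" "u - orth_proj E u \<in> avg_orth E"
    by auto
qed

lemma orth_proj_id: "v \<in> E \<Longrightarrow> orth_proj E v = v"
  by (rule orth_proj_unique) (use subspace_0[OF subspace_avg_orth] in auto)

lemma orth_proj_avg_orth: "w \<in> avg_orth E \<Longrightarrow> orth_proj E w = 0"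
  by (rule orth_proj_unique) (use subspace_0[OF E] in auto)

lemma linear_orth_proj: "linear (orth_proj E)"
proof (rule linearI)
  fix x y :: "real ^ 'n" and c :: real
  show "orth_proj E (x + y) = orth_proj E x + orth_proj E y"
    using subspace_add[OF subspace_avg_orth orth_proj_compl[of x] orth_proj_compl[of y]]
    by (intro orth_proj_unique) (auto intro: subspace_add[OF E] orth_proj_mem simp: algebra_simps)
  show "orth_proj E (c *\<^sub>R x) = c *\<^sub>R orth_proj E x"
    using subspace_scale[OF subspace_avg_orth orth_proj_compl[of x], of c]
    by (intro orth_proj_unique) (auto intro: subspace_scale[OF E] orth_proj_mem simp: algebra_simps)
qed

text \<open>The cross term vanishes by orthogonality; dropping either square shows that both
  projections are contractions.\<close>

lemma norm_orth_proj_pythagoras: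
  "norm u ^ 2 = norm (orth_proj E u) ^ 2 + norm (u - orth_proj E u) ^ 2"
proof -
  have "(u - orth_proj E u) \<bullet> orth_proj E u = 0"
    using orth_proj_compl orth_proj_mem by (auto simp: avg_orth_iff)
  then show ?thesis
    by (simp add: power2_norm_eq_inner inner_diff_left inner_diff_right inner_commute)
qed

lemma norm_orth_proj_le: "norm (orth_proj E u) \<le> norm u"
  and norm_orth_proj_compl_le: "norm (u - orth_proj E u) \<le> norm u"
  by (rule power2_le_imp_le; use norm_orth_proj_pythagoras[of u] in simp)+

end

section \<open>Spectrum of symmetric circulant matrices\<close>

text \<open>Translation by s followed by reduction modulo K permutes the residues, and g depends on
  the residue only. Negation is treated the same way below.\<close>

lemma sum_periodic_shift:
  fixes g :: "int \<Rightarrow> real"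
  assumes "K > 0" and per: "\<And>n. g (n mod K) = g n"
  shows "(\<Sum>n\<in>{0..<K}. g (n - s)) = (\<Sum>n\<in>{0..<K}. g n)"
proof (rule sum.reindex_bij_witness[where i = "\<lambda>n. (n + s) mod K" and j = "\<lambda>n. (n - s) mod K"])
qed (use assms in \<open>auto simp: mod_simps\<close>)

lemma sum_periodic_minus:
  fixes g :: "int \<Rightarrow> real"
  assumes "K > 0" and per: "\<And>n. g (n mod K) = g n"
  shows "(\<Sum>n\<in>{0..<K}. g (- n)) = (\<Sum>n\<in>{0..<K}. g n)"
proof (rule sum.reindex_bij_witness[where i = "\<lambda>n. (- n) mod K" and j = "\<lambda>n. (- n) mod K"])
qed (use assms in \<open>auto simp: mod_simps\<close>)

lemma sum_bij_label:
  fixes idx :: "'n::finite \<Rightarrow> nat" and h :: "int \<Rightarrow> real"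
  assumes "bij_betw idx UNIV {..<CARD('n)}"
  shows "(\<Sum>j\<in>UNIV. h (int (idx j))) = (\<Sum>n\<in>{0..<int CARD('n)}. h n)"
proof -
  have "bij_betw (int \<circ> idx) UNIV {0..<int CARD('n)}"
    by (rule bij_betw_trans[OF assms])
       (use image_int_atLeastLessThan[of 0 "CARD('n)"] in \<open>auto simp: bij_betw_def lessThan_atLeast0\<close>)
  from sum.reindex_bij_betw[OF this] show ?thesis by simp
qed

lemma cos_sin_root_periodic:
  fixes K :: int
  assumes "K > 0"
  shows "cos (real k * (2 * pi * real_of_int (n mod K) / K)) = cos (real k * (2 * pi * n / K))"
    and "sin (real k * (2 * pi * real_of_int (n mod K) / K)) = sin (real k * (2 * pi * n / K))"
proof -
  have "real_of_int n = real_of_int (n mod K) + real_of_int K * real_of_int (n div K)"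
    by (metis mod_mult_div_eq of_int_add of_int_mult)
  then have *: "real k * (2 * pi * n / K)
      = real k * (2 * pi * real_of_int (n mod K) / K) + 2 * pi * real_of_int (int k * (n div K))"
    using assms by (simp add: field_simps)
  have cs: "cos (x + 2 * pi * real_of_int p) = cos x" "sin (x + 2 * pi * real_of_int p) = sin x" for x p
    by (simp_all add: cos_add sin_add)
  show "cos (real k * (2 * pi * real_of_int (n mod K) / K)) = cos (real k * (2 * pi * n / K))"
    and "sin (real k * (2 * pi * real_of_int (n mod K) / K)) = sin (real k * (2 * pi * n / K))"
    unfolding * by (simp_all only: cs)
qed

section \<open>Fourier modes and symmetric circulant matrices\<close>

context
  fixes idx :: "'n::finite \<Rightarrow> nat"
  assumes idx: "bij_betw idx UNIV {..<CARD('n)}"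
begin

text \<open>Each row of A acts as a cyclic correlation with \<open>c'\<close>. The addition theorems
  split the shifted cosine and sine; symmetry makes \<open>c'\<close> even, so its sine sum vanishes
  and its cosine sum \<open>l\<close> is the common eigenvalue.\<close>

lemma circulant_eigenvectors:
  fixes A :: "real ^ 'n ^ 'n"
  assumes sym: "transpose A = A" and circ: "circulant idx A"
  shows "\<exists>l. A *v cos_mode idx k = l *\<^sub>R cos_mode idx k \<and> A *v sin_mode idx k = l *\<^sub>R sin_mode idx k"
proof -
  define K where "K = int CARD('n)"
  have K: "K > 0" by (simp add: K_def)
  have Kr: "real CARD('n) = real_of_int K" by (simp add: K_def)
  from circ obtain c where c: "\<And>i j. A $ i $ j = c ((int (idx j) - int (idx i)) mod K)"
    unfolding circulant_def K_def by blast
  define c' where "c' n = c (n mod K)" for n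
  \<comment> \<open>Every residue is a label, so the symmetry of A can be read off at an arbitrary
    n.\<close>
  have surj: "\<exists>i. int (idx i) = n mod K" for n
  proof -
    have "nat (n mod K) \<in> {..<CARD('n)}" using K by (auto simp: nat_less_iff simp flip: K_def)
    then have "nat (n mod K) \<in> range idx" using idx by (simp add: bij_betw_def)
    then obtain i where "idx i = nat (n mod K)" by (metis rangeE)
    then show ?thesis using K by (intro exI[of _ i]) simp
  qed
  have c'_sym: "c' (- n) = c' n" for n
  proof -
    \<comment> \<open>The two entries of A joining label 0 and label n mod K are \<open>c' n\<close>
      and \<open>c' (- n)\<close>.\<close>
    obtain i where i: "int (idx i) = 0 mod K" using surj by blast
    obtain j where j: "int (idx j) = n mod K" using surj by blast
    have "A $ i $ j = A $ j $ i"
      using arg_cong[OF sym, of "\<lambda>M. M $ j $ i"] by (simp add: transpose_def)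
    then show ?thesis using i j by (simp add: c c'_def mod_simps)
  qed
  define \<theta> where "\<theta> n = real k * (2 * pi * real_of_int n / K)" for n :: int
  have ang: "real k * angle idx j = \<theta> (int (idx j))" for j
    by (simp add: angle_def \<theta>_def Kr)
  have add: "\<theta> (n + p) = \<theta> n + \<theta> p" for n p
    by (simp add: \<theta>_def add_divide_distrib ring_distribs)
  have per: "cos (\<theta> (n mod K)) = cos (\<theta> n)" "sin (\<theta> (n mod K)) = sin (\<theta> n)" for n
    using cos_sin_root_periodic[OF K] by (simp_all add: \<theta>_def)
  have c'_per: "c' (n mod K) = c' n" for n by (simp add: c'_def)
  define l where "l = (\<Sum>n\<in>{0..<K}. c' n * cos (\<theta> n))"
  have odd: "(\<Sum>n\<in>{0..<K}. c' n * sin (\<theta> n)) = 0"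
  proof -
    have "(\<Sum>n\<in>{0..<K}. c' (- n) * sin (\<theta> (- n))) = (\<Sum>n\<in>{0..<K}. c' n * sin (\<theta> n))"
      by (rule sum_periodic_minus[OF K]) (simp add: per c'_per)
    moreover have "\<theta> (- n) = - \<theta> n" for n by (simp add: \<theta>_def)
    ultimately show ?thesis by (simp add: c'_sym sum_negf)
  qed
  \<comment> \<open>Taking the label difference as summation variable makes the coefficients
    independent of the row; periodicity keeps the range of summation.\<close>
  have row: "(\<Sum>j\<in>UNIV. A $ i $ j * f (int (idx j))) = (\<Sum>n\<in>{0..<K}. c' n * f (n + int (idx i)))"
    if f: "\<And>n. f (n mod K) = f n" for f i
  proof -
    have "(\<Sum>j\<in>UNIV. A $ i $ j * f (int (idx j)))
        = (\<Sum>j\<in>UNIV. (\<lambda>n. c' (n - int (idx i)) * f (n - int (idx i) + int (idx i))) (int (idx j)))"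
      by (simp add: c c'_def)
    also have "\<dots> = (\<Sum>n\<in>{0..<K}. c' (n - int (idx i)) * f (n - int (idx i) + int (idx i)))"
      unfolding K_def by (rule sum_bij_label[OF idx])
    also have "\<dots> = (\<Sum>n\<in>{0..<K}. c' n * f (n + int (idx i)))"
      by (rule sum_periodic_shift[OF K]) (metis c'_per f mod_add_left_eq)
    finally show ?thesis .
  qed
  have "A *v cos_mode idx k = l *\<^sub>R cos_mode idx k"
  proof (rule vec_eq_iff[THEN iffD2], rule allI)
    fix i
    have "(A *v cos_mode idx k) $ i = (\<Sum>n\<in>{0..<K}. c' n * cos (\<theta> (n + int (idx i))))"
      using row[of "\<lambda>n. cos (\<theta> n)" i] per
      by (simp add: matrix_vector_mult_def cos_mode_def ang)
    also have "\<dots> = cos (\<theta> (int (idx i))) * l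
        - sin (\<theta> (int (idx i))) * (\<Sum>n\<in>{0..<K}. c' n * sin (\<theta> n))"
      by (simp add: l_def add cos_add sum_distrib_left algebra_simps sum_subtractf)
    finally show "(A *v cos_mode idx k) $ i = (l *\<^sub>R cos_mode idx k) $ i"
      by (simp add: odd cos_mode_def ang)
  qed
  moreover have "A *v sin_mode idx k = l *\<^sub>R sin_mode idx k"
  proof (rule vec_eq_iff[THEN iffD2], rule allI)
    fix i
    have "(A *v sin_mode idx k) $ i = (\<Sum>n\<in>{0..<K}. c' n * sin (\<theta> (n + int (idx i))))"
      using row[of "\<lambda>n. sin (\<theta> n)" i] per
      by (simp add: matrix_vector_mult_def sin_mode_def ang)
    also have "\<dots> = sin (\<theta> (int (idx i))) * l
        + cos (\<theta> (int (idx i))) * (\<Sum>n\<in>{0..<K}. c' n * sin (\<theta> n))"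
      by (simp add: l_def add sin_add sum_distrib_left algebra_simps sum.distrib)
    finally show "(A *v sin_mode idx k) $ i = (l *\<^sub>R sin_mode idx k) $ i"
      by (simp add: odd sin_mode_def ang)
  qed
  ultimately show ?thesis by blast
qed

lemma cos_mode_nonzero: "cos_mode idx k \<noteq> 0"
proof -
  have "0 \<in> idx ` UNIV" using idx by (simp add: bij_betw_def)
  then obtain i where "idx i = 0" by auto
  then have "cos_mode idx k $ i = 1" by (simp add: cos_mode_def angle_def)
  then show ?thesis by auto
qed

text \<open>The sine mode vanishes for k = 0, so uniqueness of the eigenvalue rests on the cosine
  mode, which is nonzero for every k.\<close>

lemma mode_eigenvalue_works:
  fixes A :: "real ^ 'n ^ 'n"
  assumes "transpose A = A" "circulant idx A"
  shows "A *v cos_mode idx k = mode_eigenvalue idx A k *\<^sub>R cos_mode idx k"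
    and "A *v sin_mode idx k = mode_eigenvalue idx A k *\<^sub>R sin_mode idx k"
proof -
  have "\<exists>!l. A *v cos_mode idx k = l *\<^sub>R cos_mode idx k \<and> A *v sin_mode idx k = l *\<^sub>R sin_mode idx k"
    using circulant_eigenvectors[OF assms, of k] cos_mode_nonzero[of k]
    by (metis scaleR_cancel_right)
  from theI'[OF this]
  show "A *v cos_mode idx k = mode_eigenvalue idx A k *\<^sub>R cos_mode idx k"
    and "A *v sin_mode idx k = mode_eigenvalue idx A k *\<^sub>R sin_mode idx k"
    by (simp_all add: mode_eigenvalue_def)
qed

text \<open>This is the real part of a geometric sum of powers of a K-th root of unity; off the
  diagonal the root differs from 1 and the sum vanishes.\<close>

lemma sum_cos_angle_diff:
  "(\<Sum>k<CARD('n). cos (real k * (angle idx i - angle idx j))) = (if i = j then real CARD('n) else 0)"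
proof (cases "i = j")
  case False
  let ?K = "CARD('n)"
  define t where "t = angle idx i - angle idx j"
  have lt: "idx i < ?K" "idx j < ?K" using idx by (auto simp: bij_betw_def)
  have ne: "idx i \<noteq> idx j" using idx False by (auto simp: bij_betw_def inj_on_def)
  have t: "real ?K * t = 2 * pi * real_of_int (int (idx i) - int (idx j))"
    by (simp add: t_def angle_def field_simps)
  \<comment> \<open>Otherwise K would divide the difference of two distinct labels below K.\<close>
  have "cis t \<noteq> 1"
  proof
    assume "cis t = 1"
    then have "cos t = 1" by (simp add: complex_eq_iff)
    then obtain p :: int where "t = real_of_int p * 2 * pi" by (auto simp: cos_one_2pi_int)
    with t have "2 * pi * (real_of_int (int ?K * p)) = 2 * pi * real_of_int (int (idx i) - int (idx j))"
      by (simp add: algebra_simps)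
    then have *: "int ?K * p = int (idx i) - int (idx j)"
      by (metis mult_cancel_left of_int_eq_iff pi_neq_zero mult_eq_0_iff zero_neq_numeral)
    have "\<bar>int (idx i) - int (idx j)\<bar> < int ?K" using lt by linarith
    with * have "p = 0" by (metis abs_mult abs_of_nat dvd_triv_left dvd_imp_le_int
        linorder_not_less mult_zero_right of_nat_0_le_iff abs_ge_zero mult_eq_0_iff)
    with * ne show False by simp
  qed
  moreover have "cis t ^ ?K = 1"
    unfolding Complex.DeMoivre t by (metis cis_multiple_2pi Ints_of_int)
  ultimately have "(\<Sum>k<?K. cis t ^ k) = 0"
    by (simp add: geometric_sum)
  then have "Re (\<Sum>k<?K. cis (real k * t)) = 0" by (simp add: Complex.DeMoivre)
  then show ?thesis using False by (simp add: t_def)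
qed simp

text \<open>Discrete Fourier inversion recovers w from its coefficients at all K frequencies, and
  frequencies above K/2 are aliases of lower ones.\<close>

lemma modes_complete:
  fixes w :: "real ^ 'n"
  assumes "\<And>k. k \<le> CARD('n) div 2 \<Longrightarrow> w \<bullet> cos_mode idx k = 0"
    and "\<And>k. k \<le> CARD('n) div 2 \<Longrightarrow> w \<bullet> sin_mode idx k = 0"
  shows "w = 0"
proof -
  let ?K = "CARD('n)"
  have all: "w \<bullet> cos_mode idx k = 0 \<and> w \<bullet> sin_mode idx k = 0" if "k < ?K" for k
  proof (cases "k \<le> ?K div 2")
    case False
    \<comment> \<open>Up to multiples of 2 pi the angles for k and K - k are opposite: the cosine
      modes agree and the sine modes differ in sign.\<close>
    have *: "real k * angle idx j = 2 * pi * real (idx j) - real (?K - k) * angle idx j" for j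
      using that by (simp add: angle_def of_nat_diff field_simps)
    have cs: "cos (2 * pi * real n) = 1" "sin (2 * pi * real n) = 0" for n
      using cos_int_2pin[of "int n"] sin_int_2pin[of "int n"] by simp_all
    have "cos_mode idx k = cos_mode idx (?K - k)" "sin_mode idx k = - sin_mode idx (?K - k)"
      unfolding cos_mode_def sin_mode_def vec_eq_iff * by (simp_all add: cos_diff sin_diff cs)
    moreover have "?K - k \<le> ?K div 2" using False by linarith
    ultimately show ?thesis using assms[of "?K - k"] by simp
  qed (use assms in auto)
  have "w $ i = 0" for i
  proof -
    have "0 = (\<Sum>k<?K. cos (real k * angle idx i) * (w \<bullet> cos_mode idx k)
        + sin (real k * angle idx i) * (w \<bullet> sin_mode idx k))"
      using all by simp
    \<comment> \<open>The formula for cos (x - y) produces the kernel that vanishes off the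
      diagonal.\<close>
    also have "\<dots> = (\<Sum>k<?K. \<Sum>j\<in>UNIV. w $ j * cos (real k * (angle idx i - angle idx j)))"
      by (simp add: inner_vec_def cos_mode_def sin_mode_def sum_distrib_left right_diff_distrib
          cos_diff algebra_simps flip: sum.distrib)
    also have "\<dots> = (\<Sum>j\<in>UNIV. w $ j * (\<Sum>k<?K. cos (real k * (angle idx i - angle idx j))))"
      by (subst sum.swap) (simp add: sum_distrib_left)
    also have "\<dots> = w $ i * real ?K"
      unfolding sum_cos_angle_diff by (simp add: if_distrib cong: if_cong)
    finally show ?thesis by simp
  qed
  then show ?thesis by (simp add: vec_eq_iff)
qed

section \<open>The spectral gap at the dominant mode\<close>

context
  fixes A :: "real ^ 'n ^ 'n" and m :: nat
  assumes sym: "transpose A = A" and circ: "circulant idx A" and dom: "dominant_mode idx A m"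
begin

lemma inner_matrix_sym: "(A *v x) \<bullet> y = x \<bullet> (A *v y)"
  using dot_lmul_matrix[of x A y] sym by (metis transpose_matrix_vector)

lemma matrix_on_mode_space:
  assumes "v \<in> mode_space idx m"
  shows "A *v v = mode_eigenvalue idx A m *\<^sub>R v"
  using assms unfolding mode_space_def
proof (induction rule: span_induct_alt)
  case (step c x y)
  then show ?case using mode_eigenvalue_works[OF sym circ, of m]
    by (auto simp: matrix_vector_right_distrib matrix_vector_mult_scaleR algebra_simps)
qed simp

text \<open>A is self-adjoint and acts as a scalar on the mode space, so moving A to the other
  factor only rescales an inner product that is already 0.\<close>

lemma matrix_avg_orth_invariant:
  assumes "w \<in> avg_orth (mode_space idx m)"
  shows "A *v w \<in> avg_orth (mode_space idx m)"
  using assms by (auto simp: avg_orth_iff inner_matrix_sym matrix_on_mode_space)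

text \<open>Eigenvectors of a symmetric matrix for different eigenvalues are orthogonal, so w is
  orthogonal to all modes with k different from m, and by hypothesis to those with k = m. This makes
  \<open>d - \<alpha>c A\<close> injective on the complement.\<close>

lemma dominant_eigenspace:
  assumes w: "w \<in> avg_orth (mode_space idx m)" and eig: "A *v w = mode_eigenvalue idx A m *\<^sub>R w"
  shows "w = 0"
proof (rule modes_complete)
  fix k assume k: "k \<le> CARD('n) div 2"
  have "w \<bullet> x = 0" if x: "A *v x = mode_eigenvalue idx A k *\<^sub>R x" "k \<noteq> m" for x
  proof -
    have "mode_eigenvalue idx A m * (w \<bullet> x) = mode_eigenvalue idx A k * (w \<bullet> x)"
      using inner_matrix_sym[of w x] by (simp add: eig x)
    moreover have "mode_eigenvalue idx A k < mode_eigenvalue idx A m"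
      using dom k x by (simp add: dominant_mode_def)
    ultimately show ?thesis by simp
  qed
  moreover have "w \<bullet> x = 0" if "x \<in> {cos_mode idx m, sin_mode idx m}" for x
    using w that by (auto simp: avg_orth_iff mode_space_def span_base)
  ultimately show "w \<bullet> cos_mode idx k = 0" "w \<bullet> sin_mode idx k = 0"
    using mode_eigenvalue_works[OF sym circ, of k] by (cases "k = m"; blast)+
qed

end
end

section \<open>Estimates for the reduction\<close>

lemma norm_times_vec_le: "norm (u * v) \<le> norm u * norm v" for u v :: "real ^ 'n"
proof -
  have "norm (u * v) \<le> norm (norm u *\<^sub>R v)"
    by (rule norm_le_componentwise_cart) (simp add: abs_mult mult_right_mono component_le_norm_cart)
  then show ?thesis by simp
qed

text \<open>The exponent must be positive: \<open>u ^ 0\<close> is the all-ones vector, whose norm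
  is the square root of K.\<close>

lemma norm_power_vec_le: "norm (u ^ Suc n) \<le> norm u ^ Suc n" for u :: "real ^ 'n"
proof (induction n)
  case (Suc n)
  have "norm (u ^ Suc (Suc n)) \<le> norm u * norm (u ^ Suc n)"
    using norm_times_vec_le[of u "u ^ Suc n"] by simp
  also have "\<dots> \<le> norm u * norm u ^ Suc n"
    by (rule mult_left_mono[OF Suc.IH]) simp
  finally show ?case by simp
qed simp

lemma power_vec_component: "(u ^ n) $ j = (u $ j) ^ n" for u :: "real ^ 'n"
  by (induction n) simp_all

lemma scaleR_power_vec: "(c *\<^sub>R u) ^ n = c ^ n *\<^sub>R u ^ n" for u :: "real ^ 'n"
  by (simp add: vec_eq_iff power_vec_component power_mult_distrib)

text \<open>Every term of the expanded difference contains the factor q, and its coefficients 3, 3,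
  1 are dominated by the coefficients 3, 6, 3 of the right-hand side.\<close>

lemma norm_cube_diff_le:
  fixes p q :: "real ^ 'n"
  shows "norm ((p + q) ^ 3 - p ^ 3) \<le> 3 * norm q * (norm p + norm q) ^ 2"
proof -
  have eq: "(p + q) ^ 3 - p ^ 3 = 3 *\<^sub>R (q * (p * p)) + 3 *\<^sub>R (q * (p * q)) + q * (q * q)"
    by (simp add: vec_eq_iff power_vec_component) (simp add: power3_eq_cube algebra_simps)
  have t: "norm (q * (x * y)) \<le> norm q * (norm x * norm y)" for x y
    by (meson norm_times_vec_le mult_left_mono norm_ge_zero order_trans)
  have "norm ((p + q) ^ 3 - p ^ 3)
      \<le> 3 * norm (q * (p * p)) + 3 * norm (q * (p * q)) + norm (q * (q * q))"
    unfolding eq using norm_triangle_ineq[of "3 *\<^sub>R (q * (p * p))" "3 *\<^sub>R (q * (p * q))"]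
      norm_triangle_ineq[of "3 *\<^sub>R (q * (p * p)) + 3 *\<^sub>R (q * (p * q))" "q * (q * q)"] by simp
  also have "\<dots> \<le> 3 * (norm q * (norm p * norm p)) + 3 * (norm q * (norm p * norm q))
      + norm q * (norm q * norm q)"
    by (intro add_mono mult_left_mono t) auto
  also have "\<dots> \<le> 3 * norm q * (norm p + norm q) ^ 2"
  proof -
    have "0 \<le> 3 * (norm q * (norm p * norm q)) + 2 * (norm q * (norm q * norm q))"
      by simp
    then show ?thesis by (simp add: power2_eq_square algebra_simps)
  qed
  finally show ?thesis .
qed

text \<open>To be read with a, \<open>\<beta>\<close>, t as the norms of v, b, \<open>\<mu>\<close>,
  the common right-hand factor being the sum of the five weights. The first bound serves the cubic
  cross terms, the second the quintic Taylor remainder. Smallness enters through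
  \<open>a ^ 3 \<le> a\<close> and similar absorptions.\<close>

lemma weight_bounds:
  fixes a \<beta> t :: real
  assumes a: "0 \<le> a" "a \<le> 1" and \<beta>: "0 \<le> \<beta>" "\<beta> \<le> 1" and t: "0 \<le> t"
  shows "(a ^ 3 + \<beta>) * (a + (a ^ 3 + \<beta>)) ^ 2
      \<le> 8 * (a ^ 5 + t * a ^ 3 + \<beta> * a ^ 2 + \<beta> ^ 2 * a + \<beta> ^ 3)" (is "?l1 \<le> 8 * ?w")
    and "(a + (a ^ 3 + \<beta>)) ^ 5 \<le> 243 * (a ^ 5 + t * a ^ 3 + \<beta> * a ^ 2 + \<beta> ^ 2 * a + \<beta> ^ 3)"
proof -
  have cube: "a ^ 3 \<le> a" using a power_decreasing[of 1 3 a] by simp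
  have nn: "0 \<le> a ^ 5" "0 \<le> t * a ^ 3" "0 \<le> \<beta> * a ^ 2" "0 \<le> \<beta> ^ 2 * a" "0 \<le> \<beta> ^ 3" "0 \<le> a ^ 3"
    using a \<beta> t by simp_all
  have "?l1 \<le> (a ^ 3 + \<beta>) * (2 * a + \<beta>) ^ 2"
    using a \<beta> cube nn by (intro mult_left_mono power_mono) auto
  also have "\<dots> = 4 * a ^ 5 + 4 * (\<beta> * a ^ 4) + \<beta> ^ 2 * a ^ 3 + 4 * (\<beta> * a ^ 2) + 4 * (\<beta> ^ 2 * a) + \<beta> ^ 3"
    by (simp add: algebra_simps eval_nat_numeral)
  also have "\<dots> \<le> 8 * ?w"
  proof -
    have "\<beta> * a ^ 4 \<le> \<beta> * a ^ 2" "\<beta> ^ 2 * a ^ 3 \<le> \<beta> ^ 2 * a"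
      using a \<beta> cube power_decreasing[of 2 4 a] by (auto intro: mult_left_mono)
    then show ?thesis using nn by argo
  qed
  finally show "?l1 \<le> 8 * ?w" .
  \<comment> \<open>Each of the three summands is at most h, giving 243 = 3^5; the fifth power of h
    is then below \<open>a ^ 5\<close> or \<open>\<beta> ^ 3\<close>.\<close>
  define h where "h = max a \<beta>"
  have h0: "0 \<le> h" using a by (simp add: h_def)
  have "(a + (a ^ 3 + \<beta>)) ^ 5 \<le> (3 * h) ^ 5"
    using a \<beta> cube nn by (intro power_mono) (auto simp: h_def)
  also have "\<dots> = 243 * h ^ 5" by (simp add: power_mult_distrib)
  also have "h ^ 5 \<le> ?w"
  proof (cases "a \<le> \<beta>")
    case True
    have "\<beta> ^ 5 \<le> \<beta> ^ 3" using \<beta> power_decreasing[of 3 5 \<beta>] by simp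
    then have "\<beta> ^ 5 \<le> ?w" using nn by argo
    then show ?thesis using True by (simp add: h_def max_absorb2)
  next
    case False
    have "a ^ 5 \<le> ?w" using nn by argo
    then show ?thesis using False by (simp add: h_def max_absorb1)
  qed
  finally show "(a + (a ^ 3 + \<beta>)) ^ 5 \<le> 243 * ?w" by simp
qed

text \<open>Convexity of the cube, with equality at a = b = c. The proof writes the difference as a
  combination of squares with nonnegative coefficients.\<close>

lemma cube_sum3_le:
  fixes a b c :: real
  assumes "0 \<le> a" "0 \<le> b" "0 \<le> c"
  shows "(a + b + c) ^ 3 \<le> 9 * (a ^ 3 + b ^ 3 + c ^ 3)"
proof -
  have nn: "0 \<le> (a + b) * (a - b) ^ 2" "0 \<le> (b + c) * (b - c) ^ 2" "0 \<le> (a + c) * (a - c) ^ 2"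
    "0 \<le> a * (b - c) ^ 2" "0 \<le> b * (a - c) ^ 2" "0 \<le> c * (a - b) ^ 2"
    using assms by simp_all
  have "9 * (a ^ 3 + b ^ 3 + c ^ 3) - (a + b + c) ^ 3
    = 4 * ((a + b) * (a - b) ^ 2 + (b + c) * (b - c) ^ 2 + (a + c) * (a - c) ^ 2)
      + (a * (b - c) ^ 2 + b * (a - c) ^ 2 + c * (a - b) ^ 2)"
    by (simp add: power3_eq_cube power2_eq_square algebra_simps)
  with nn show ?thesis by argo
qed

text \<open>A self-improving estimate for \<open>\<omega>\<close>, the norm of w. After splitting
  the cube, \<open>9 N \<omega>^3\<close> is at most \<open>c/4 \<omega>\<close> by
  \<open>small\<close>; together with the other \<open>c/4 \<omega>\<close> it is absorbed on the
  left, which keeps \<open>c/2 \<omega>\<close>.\<close>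

lemma complement_size_bound:
  fixes a \<beta> \<omega> c N :: real
  assumes nn: "0 \<le> a" "0 \<le> \<beta>" "\<beta> \<le> 1" "0 \<le> \<omega>" "0 \<le> N" and c: "c > 0"
    and small: "36 * N * \<omega> ^ 2 \<le> c"
    and eq: "c * \<omega> \<le> c / 4 * \<omega> + \<beta> + N * (a + \<omega> + \<beta>) ^ 3"
  shows "\<omega> \<le> 2 / c * (1 + 9 * N) * (a ^ 3 + \<beta>)"
proof -
  have "N * (a + \<omega> + \<beta>) ^ 3 \<le> N * (9 * (a ^ 3 + \<omega> ^ 3 + \<beta> ^ 3))"
    using cube_sum3_le nn by (intro mult_left_mono) auto
  moreover have "36 * N * \<omega> ^ 2 * \<omega> \<le> c * \<omega>" by (rule mult_right_mono[OF small]) fact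
  moreover have "N * \<beta> ^ 3 \<le> N * \<beta>"
    using nn power_decreasing[of 1 3 \<beta>] by (intro mult_left_mono) auto
  ultimately have "c / 2 * \<omega> \<le> \<beta> + 9 * (N * a ^ 3) + 9 * (N * \<beta>)"
    using eq by (simp add: power3_eq_cube power2_eq_square algebra_simps)
  also have "\<dots> \<le> (1 + 9 * N) * (a ^ 3 + \<beta>)"
    using nn by (simp add: algebra_simps)
  finally show ?thesis using c by (simp add: field_simps)
qed

text \<open>Since division by 0 yields 0, the part vanishes when T = 0 and the bound still
  holds.\<close>

lemma norm_proportional_part_le:
  fixes R :: "'a::real_normed_vector"
  assumes "norm R \<le> C * T" "0 \<le> t" "0 \<le> T" "0 \<le> C"
  shows "norm ((t / T) *\<^sub>R R) \<le> C * t"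
proof (cases "T = 0")
  case False
  have "t / T * norm R \<le> t / T * (C * T)" using assms by (intro mult_left_mono) auto
  then show ?thesis using assms False by (simp add: field_simps)
qed (use assms in simp)

text \<open>The shares add up to 1 unless all is divided by 0, and then the hypothesis forces R = 0.
  Thus one bound by a sum of weights becomes a sum of terms with one weight each.\<close>

lemma sum_proportional_parts:
  fixes R :: "'a::real_normed_vector"
  assumes "norm R \<le> C * (t1 + t2 + t3 + t4 + t5)" (is "_ \<le> C * ?T")
  shows "(t1 / ?T) *\<^sub>R R + (t2 / ?T) *\<^sub>R R + (t3 / ?T) *\<^sub>R R + (t4 / ?T) *\<^sub>R R + (t5 / ?T) *\<^sub>R R = R"
proof (cases "?T = 0")
  case False
  then have "t1 / ?T + t2 / ?T + t3 / ?T + t4 / ?T + t5 / ?T = 1"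
    by (simp flip: add_divide_distrib)
  then show ?thesis by (metis scaleR_add_left scaleR_one)
qed (use assms in simp)

text \<open>Here g is the nonlinear part of S at its argument x. As A preserves both E and its
  complement, the linear terms in w drop out of the projected equation; the complementary one is
  arranged with the operator at \<open>\<alpha>c\<close> on the left.\<close>

lemma lyapunov_schmidt_equations:
  fixes A :: "real ^ 'n ^ 'n" and x :: "real ^ 'n"
  assumes E: "subspace E" and AE: "\<And>u. u \<in> E \<Longrightarrow> A *v u = l *\<^sub>R u"
    and AE': "\<And>u. u \<in> avg_orth E \<Longrightarrow> A *v u \<in> avg_orth E"
    and v: "v \<in> E" and w: "w \<in> avg_orth E"
    and d: "\<alpha>c * l = d" and \<alpha>: "(\<alpha> - \<alpha>c) * l = \<mu>"
    and x: "x = \<alpha> *\<^sub>R (A *v (v + w)) + b" and g: "g = (\<chi> j. S (x $ j)) - x"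
  shows "orth_proj E (field_map d S A (v + w) \<alpha> b) = \<mu> *\<^sub>R v + orth_proj E b + orth_proj E g"
    and "field_map d S A (v + w) \<alpha> b - orth_proj E (field_map d S A (v + w) \<alpha> b) = 0 \<Longrightarrow>
      d *\<^sub>R w - \<alpha>c *\<^sub>R (A *v w) = (\<alpha> - \<alpha>c) *\<^sub>R (A *v w) + (b - orth_proj E b) + (g - orth_proj E g)"
proof -
  interpret P: linear "orth_proj E" by (rule linear_orth_proj[OF E])
  have F: "field_map d S A (v + w) \<alpha> b = - (d *\<^sub>R (v + w)) + (x + g)"
    by (simp add: field_map_def g flip: x)
  have Pv: "orth_proj E v = v" and Pw: "orth_proj E w = 0" and PAw: "orth_proj E (A *v w) = 0"
    using orth_proj_id[OF E v] orth_proj_avg_orth[OF E] w AE' by auto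
  have "\<alpha> * l - d = \<mu>" using d \<alpha> by (simp add: algebra_simps)
  then have \<mu>: "\<alpha> * l = d + \<mu>" by simp
  \<comment> \<open>On E the operator \<open>\<alpha> A\<close> is multiplication by
    \<open>d + \<mu>\<close>, so that only \<open>\<mu> v\<close> survives the subtraction of d
    v.\<close>
  have xe: "x = (d + \<mu>) *\<^sub>R v + \<alpha> *\<^sub>R (A *v w) + b"
    by (simp add: x matrix_vector_right_distrib AE[OF v] \<mu> algebra_simps)
  have PF: "orth_proj E (field_map d S A (v + w) \<alpha> b) = \<mu> *\<^sub>R v + orth_proj E b + orth_proj E g"
  proof -
    have "field_map d S A (v + w) \<alpha> b = \<mu> *\<^sub>R v + (\<alpha> *\<^sub>R (A *v w) - d *\<^sub>R w) + b + g"
      unfolding F xe by (simp add: algebra_simps)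
    then show ?thesis by (simp add: P.add P.diff P.scale Pv Pw PAw)
  qed
  then show "orth_proj E (field_map d S A (v + w) \<alpha> b) = \<mu> *\<^sub>R v + orth_proj E b + orth_proj E g" .
  assume "field_map d S A (v + w) \<alpha> b - orth_proj E (field_map d S A (v + w) \<alpha> b) = 0"
  then have "- (d *\<^sub>R (v + w)) + (x + g) - (\<mu> *\<^sub>R v + orth_proj E b + orth_proj E g) = 0"
    unfolding PF unfolding F .
  then show "d *\<^sub>R w - \<alpha>c *\<^sub>R (A *v w) = (\<alpha> - \<alpha>c) *\<^sub>R (A *v w) + (b - orth_proj E b) + (g - orth_proj E g)"
    unfolding xe by (simp add: algebra_simps)
qed

text \<open>Four of the five factors of a component are replaced by the full norm; comparison with a
  multiple of x then gives a constant independent of K.\<close>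

lemma componentwise_expansion:
  fixes x :: "real ^ 'n"
  assumes S: "\<And>y. \<bar>y\<bar> \<le> \<rho> \<Longrightarrow> \<bar>S y - (y + s * y ^ 3)\<bar> \<le> M * \<bar>y\<bar> ^ 5" and M: "0 \<le> M"
    and x: "norm x \<le> \<rho>"
  shows "norm ((\<chi> j. S (x $ j)) - x - s *\<^sub>R x ^ 3) \<le> M * norm x ^ 5"
proof -
  have "norm ((\<chi> j. S (x $ j)) - x - s *\<^sub>R x ^ 3) \<le> norm ((M * norm x ^ 4) *\<^sub>R x)"
  proof (rule norm_le_componentwise_cart)
    fix j
    have xj: "\<bar>x $ j\<bar> \<le> norm x" by (rule component_le_norm_cart)
    have "\<bar>S (x $ j) - (x $ j + s * (x $ j) ^ 3)\<bar> \<le> M * \<bar>x $ j\<bar> ^ 5"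
      using x xj by (intro S) simp
    also have "\<dots> = M * \<bar>x $ j\<bar> ^ 4 * \<bar>x $ j\<bar>" by (simp add: eval_nat_numeral)
    also have "\<dots> \<le> M * norm x ^ 4 * \<bar>x $ j\<bar>"
      using M xj by (intro mult_right_mono mult_left_mono power_mono) auto
    finally show "norm (((\<chi> j. S (x $ j)) - x - s *\<^sub>R x ^ 3) $ j) \<le> norm (((M * norm x ^ 4) *\<^sub>R x) $ j)"
      using M by (simp add: power_vec_component abs_mult algebra_simps)
  qed
  also have "\<dots> = M * norm x ^ 5" using M by (simp add: abs_mult eval_nat_numeral)
  finally show ?thesis .
qed

section \<open>The expansion of the reduced map\<close>

theorem lemma1:
  fixes idx :: "'n::finite \<Rightarrow> nat"
    and A :: "real ^ 'n ^ 'n"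
    and m :: nat
    and d \<delta> :: real
    and S :: "real \<Rightarrow> real"
    and U :: "((real ^ 'n) \<times> real \<times> (real ^ 'n)) set"
    and W :: "real ^ 'n \<Rightarrow> real \<Rightarrow> real ^ 'n \<Rightarrow> real ^ 'n"
  defines "E \<equiv> mode_space idx m"
    and "F \<equiv> field_map d S A"
    and "l \<equiv> mode_eigenvalue idx A m"
    and "\<alpha>c \<equiv> d / mode_eigenvalue idx A m"
    and "s3 \<equiv> (deriv ^^ 3) S 0"
  assumes idx: "bij_betw idx UNIV {..<CARD('n)}"
    and sym: "transpose A = A"
    and circ: "circulant idx A"
    and dom: "dominant_mode idx A m"
    and d: "d > 0"
    and S_odd: "\<And>x. S (- x) = - S x"
    and S_C3: "Ck_on 3 UNIV S"
    and S_sig: "sigmoidal S"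
    and S_1: "deriv S 0 = 1"
    and S_3: "s3 \<noteq> 0"
    and S_C5_near_0: "\<delta> > 0" "Ck_on 5 {- \<delta> <..< \<delta>} S"
    and W: "lyapunov_schmidt_map E F \<alpha>c U W"
  shows "\<exists>N C R1 R2 R3 R4 R5.
    open N \<and> (0, 0, 0) \<in> N \<and>
    (\<forall>v \<mu> b. (v, \<mu>, b) \<in> N \<longrightarrow> v \<in> E \<longrightarrow>
       (v, \<alpha>c + \<mu> / l, b) \<in> U \<and>
       reduced_map E F \<alpha>c l W v \<mu> b =
         \<mu> *\<^sub>R v + orth_proj E b
         + (s3 / 6 * \<alpha>c ^ 3) *\<^sub>R orth_proj E ((A *v v) ^ 3)
         + (s3 / 2 * \<alpha>c ^ 2) *\<^sub>R orth_proj E ((A *v v) ^ 2 * b)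
         + (R1 v \<mu> b + R2 v \<mu> b + R3 v \<mu> b + R4 v \<mu> b + R5 v \<mu> b) \<and>
       norm (R1 v \<mu> b) \<le> C * norm v ^ 5 \<and>
       norm (R2 v \<mu> b) \<le> C * (\<bar>\<mu>\<bar> * norm v ^ 3) \<and>
       norm (R3 v \<mu> b) \<le> C * (norm b * norm v ^ 2) \<and>
       norm (R4 v \<mu> b) \<le> C * (norm b ^ 2 * norm v) \<and>
       norm (R5 v \<mu> b) \<le> C * norm b ^ 3)"
proof -
  have E: "subspace E" by (simp add: E_def mode_space_def)
  have l: "l > 0" using dom by (simp add: l_def dominant_mode_def)
  have \<alpha>c: "\<alpha>c * l = d" "\<alpha>c > 0" using l d by (simp_all add: \<alpha>c_def l_def)
  have AE: "A *v u = l *\<^sub>R u" if "u \<in> E" for u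
    using matrix_on_mode_space[OF idx sym circ dom] that by (simp add: E_def l_def)
  have AE': "A *v u \<in> avg_orth E" if "u \<in> avg_orth E" for u
    using matrix_avg_orth_invariant[OF idx sym circ dom] that by (simp add: E_def)
  interpret P: linear "orth_proj E" by (rule linear_orth_proj[OF E])
  note P_le = norm_orth_proj_le[OF E] and Q_le = norm_orth_proj_compl_le[OF E]

  have scaled_P_le: "norm (k *\<^sub>R orth_proj E u) \<le> \<bar>k\<bar> * norm u" for k u
    by (simp add: P_le mult_left_mono)

  define s where "s = s3 / 6"
  obtain M where M: "0 \<le> M"
    and S_exp: "\<And>y. \<bar>y\<bar> \<le> \<delta> / 2 \<Longrightarrow> \<bar>S y - (y + s * y ^ 3)\<bar> \<le> M * \<bar>y\<bar> ^ 5"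
    using odd_C5_expansion[OF S_odd S_C5_near_0] by (auto simp: S_1 s_def s3_def)
  obtain B where B: "B > 0" "\<And>u. norm (A *v u) \<le> B * norm u"
    using linear_bounded_pos[of "(*v) A"] by auto

  \<comment> \<open>In finite dimension an injective linear map on a subspace is bounded below; this
    supplies the constant c that controls w.\<close>
  let ?T = "\<lambda>u. d *\<^sub>R u - \<alpha>c *\<^sub>R (A *v u)"
  have "\<exists>c>0. \<forall>u\<in>avg_orth E. norm (?T u) \<ge> c * norm u"
  proof (rule injective_imp_isometric)
    show "closed (avg_orth E)" "subspace (avg_orth E)"
      using subspace_avg_orth closed_subspace by blast+
    show "bounded_linear ?T"
      by (intro linear_conv_bounded_linear[THEN iffD1] linearI)
         (simp_all add: matrix_vector_right_distrib matrix_vector_mult_scaleR algebra_simps)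
    show "\<forall>u\<in>avg_orth E. ?T u = 0 \<longrightarrow> u = 0"
    proof (intro ballI impI)
      fix u assume u: "u \<in> avg_orth E" "?T u = 0"
      then have "\<alpha>c *\<^sub>R (A *v u) = \<alpha>c *\<^sub>R (l *\<^sub>R u)" using \<alpha>c by simp
      then have "A *v u = l *\<^sub>R u" using \<alpha>c by (metis less_irrefl scaleR_left_imp_eq)
      then show "u = 0"
        using dominant_eigenspace[OF idx sym circ dom] u by (simp add: E_def l_def)
    qed
  qed
  then obtain c where c: "c > 0" "\<And>u. u \<in> avg_orth E \<Longrightarrow> c * norm u \<le> norm (?T u)" by blast

  \<comment> \<open>With \<open>\<alpha>\<close> within 1 of \<open>\<alpha>c\<close>, L bounds
    \<open>\<alpha> A\<close>, the added 1 covering b. N0 bounds g by a cube, C1 comes from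
    \<open>complement_size_bound\<close>, D bounds p and q below, and C adds up the four error
    contributions \<open>t1\<close> to \<open>t4\<close>.\<close>
  define L where "L = (\<alpha>c + 1) * B + 1"
  define N0 where "N0 = (\<bar>s\<bar> + M) * L ^ 3"
  define C1 where "C1 = 2 / c * (1 + 9 * N0)"
  define D where "D = L * (C1 + 1)"
  define C where "C = \<bar>s\<bar> * (24 * D ^ 3) + \<bar>s\<bar> * (3 * (\<alpha>c + 1) ^ 2 / l) * B ^ 3
    + M * (243 * D ^ 5) + \<bar>s3 / 2 * \<alpha>c ^ 2\<bar> * B ^ 2"
  have L: "L \<ge> 1" using B \<alpha>c by (simp add: L_def)
  have N0: "N0 \<ge> 0" using M L by (simp add: N0_def)
  have C1: "C1 \<ge> 0" using N0 c by (simp add: C1_def)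
  have D: "L \<le> D" "D \<ge> 1" using L C1 by (simp_all add: D_def algebra_simps add_increasing2 mult_nonneg_nonneg)
  have C: "C \<ge> 0" unfolding C_def using M l D B \<alpha>c by (intro add_nonneg_nonneg mult_nonneg_nonneg) auto

  \<comment> \<open>Composition with the projection gives the map whose smoothness is assumed on a
    full neighbourhood; on E it agrees with W.\<close>
  define w where "w v \<mu> b = W (orth_proj E v) (\<alpha>c + \<mu> / l) b" for v \<mu> b
  \<comment> \<open>The conditions keep \<open>\<alpha>\<close> near \<open>\<alpha>c\<close>, let
    the change of \<open>\<alpha>\<close> cost at most c/4 in the complementary equation, provide
    \<open>small\<close> for \<open>complement_size_bound\<close>, and keep x where the Taylor bound
    holds and its norm is at most 1.\<close>
  define good where "good v \<mu> b \<longleftrightarrow> (v, \<alpha>c + \<mu> / l, b) \<in> U \<and> norm v < 1 \<and> norm b < 1 \<and> \<bar>\<mu> / l\<bar> < 1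
    \<and> \<bar>\<mu> / l\<bar> * B < c / 4 \<and> 36 * N0 * norm (w v \<mu> b) ^ 2 < c
    \<and> L * (norm v + norm (w v \<mu> b) + norm b) < min (\<delta> / 2) 1" for v \<mu> b
  define wt where "wt v \<mu> b = norm v ^ 5 + \<bar>\<mu>\<bar> * norm v ^ 3 + norm b * norm v ^ 2
    + norm b ^ 2 * norm v + norm b ^ 3" for v b :: "real ^ 'n" and \<mu> :: real
  define Rest where "Rest v \<mu> b = reduced_map E F \<alpha>c l W v \<mu> b - (\<mu> *\<^sub>R v + orth_proj E b
         + (s3 / 6 * \<alpha>c ^ 3) *\<^sub>R orth_proj E ((A *v v) ^ 3)
         + (s3 / 2 * \<alpha>c ^ 2) *\<^sub>R orth_proj E ((A *v v) ^ 2 * b))" for v \<mu> b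

  have Wprops: "open U" "(0, \<alpha>c, 0) \<in> U" "W 0 \<alpha>c 0 = 0"
    "Ck_on 3 {(v, \<alpha>, b). (orth_proj E v, \<alpha>, b) \<in> U} (\<lambda>(v, \<alpha>, b). W (orth_proj E v) \<alpha> b)"
    "\<And>v \<alpha> b. (v, \<alpha>, b) \<in> U \<Longrightarrow> v \<in> E \<Longrightarrow> W v \<alpha> b \<in> avg_orth E \<and>
       F (v + W v \<alpha> b) \<alpha> b - orth_proj E (F (v + W v \<alpha> b) \<alpha> b) = 0"
    using W by (simp_all only: lyapunov_schmidt_map_def)

  have "\<forall>\<^sub>F p in nhds (0, 0, 0). good (fst p) (fst (snd p)) (snd (snd p))"
  proof -
    \<comment> \<open>Differentiability at the base point gives continuity there, so w tends to 0;
      all conditions in \<open>good\<close> are open and hold in the limit.\<close>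
    have "(\<lambda>(v, \<alpha>, b). W (orth_proj E v) \<alpha> b) differentiable (at (0, \<alpha>c, 0))"
      using Wprops(2,4) by (simp add: numeral_3_eq_3 P.zero)
    then have cont: "isCont (\<lambda>(v, \<alpha>, b). W (orth_proj E v) \<alpha> b) (0, \<alpha>c, 0)"
      by (rule differentiable_imp_continuous_within)
    let ?h = "\<lambda>p :: (real ^ 'n) \<times> real \<times> (real ^ 'n). (fst p, \<alpha>c + fst (snd p) / l, snd (snd p))"
    have id0: "((\<lambda>p. p) \<longlongrightarrow> (0, 0, 0)) (nhds (0 :: real ^ 'n, 0 :: real, 0 :: real ^ 'n))"
      by (rule filterlim_ident)
    have fst0: "(fst \<longlongrightarrow> (0 :: real ^ 'n)) (nhds (0 :: real ^ 'n, 0 :: real, 0 :: real ^ 'n))"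
      and mu0: "((\<lambda>p. fst (snd p)) \<longlongrightarrow> (0 :: real)) (nhds (0 :: real ^ 'n, 0 :: real, 0 :: real ^ 'n))"
      and b0: "((\<lambda>p. snd (snd p)) \<longlongrightarrow> (0 :: real ^ 'n)) (nhds (0 :: real ^ 'n, 0 :: real, 0 :: real ^ 'n))"
      using tendsto_fst[OF id0] tendsto_fst[OF tendsto_snd[OF id0]]
        tendsto_snd[OF tendsto_snd[OF id0]] by simp_all
    have h: "(?h \<longlongrightarrow> (0, \<alpha>c, 0)) (nhds (0, 0, 0))"
      using tendsto_Pair[OF fst0 tendsto_Pair[OF tendsto_add[OF tendsto_const
            tendsto_divide[OF mu0 tendsto_const]] b0], of l \<alpha>c] l by simp
    have mul0: "((\<lambda>p. \<bar>fst (snd p) / l\<bar>) \<longlongrightarrow> 0) (nhds (0 :: real ^ 'n, 0 :: real, 0 :: real ^ 'n))"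
      using tendsto_rabs[OF tendsto_divide[OF mu0 tendsto_const, of l]] l by simp
    have w0: "((\<lambda>p. w (fst p) (fst (snd p)) (snd (snd p))) \<longlongrightarrow> 0) (nhds (0, 0, 0))"
      using isCont_tendsto_compose[OF cont h] Wprops(3) by (simp add: w_def P.zero)
    have "\<forall>\<^sub>F p in nhds (0, 0, 0). ?h p \<in> U"
      using topological_tendstoD[OF h Wprops(1,2)] .
    moreover have "\<forall>\<^sub>F p in nhds (0 :: real ^ 'n, 0 :: real, 0 :: real ^ 'n). norm (fst p) < 1"
      by (rule order_tendstoD(2)[OF tendsto_norm[OF fst0]]) simp
    moreover have "\<forall>\<^sub>F p in nhds (0 :: real ^ 'n, 0 :: real, 0 :: real ^ 'n). norm (snd (snd p)) < 1"
      by (rule order_tendstoD(2)[OF tendsto_norm[OF b0]]) simp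
    moreover have "\<forall>\<^sub>F p in nhds (0 :: real ^ 'n, 0 :: real, 0 :: real ^ 'n). \<bar>fst (snd p) / l\<bar> < 1"
      by (rule order_tendstoD(2)[OF mul0]) simp
    moreover have "\<forall>\<^sub>F p in nhds (0 :: real ^ 'n, 0 :: real, 0 :: real ^ 'n). \<bar>fst (snd p) / l\<bar> * B < c / 4"
      by (rule order_tendstoD(2)[OF tendsto_mult[OF mul0 tendsto_const]]) (use c in simp)
    moreover have "\<forall>\<^sub>F p in nhds (0, 0, 0). 36 * N0 * norm (w (fst p) (fst (snd p)) (snd (snd p))) ^ 2 < c"
      by (rule order_tendstoD(2)[OF tendsto_mult[OF tendsto_const tendsto_power[OF tendsto_norm[OF w0]]]])
         (use c in simp)
    moreover have "\<forall>\<^sub>F p in nhds (0, 0, 0).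
        L * (norm (fst p) + norm (w (fst p) (fst (snd p)) (snd (snd p))) + norm (snd (snd p))) < min (\<delta> / 2) 1"
      by (rule order_tendstoD(2)[OF tendsto_mult[OF tendsto_const tendsto_add[OF
              tendsto_add[OF tendsto_norm[OF fst0] tendsto_norm[OF w0]] tendsto_norm[OF b0]]]])
         (use S_C5_near_0(1) in simp)
    ultimately show ?thesis unfolding good_def by eventually_elim blast
  qed
  then obtain N where N: "open N" "(0, 0, 0) \<in> N" "\<And>v \<mu> b. (v, \<mu>, b) \<in> N \<Longrightarrow> good v \<mu> b"
    unfolding eventually_nhds by fastforce

  have Rest: "norm (Rest v \<mu> b) \<le> C * wt v \<mu> b" if good: "good v \<mu> b" and v: "v \<in> E" for v \<mu> b
  proof -
    define \<alpha> where "\<alpha> = \<alpha>c + \<mu> / l"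
    define \<omega> where "\<omega> = w v \<mu> b"
    have W_eq: "W v \<alpha> b = \<omega>" using v by (simp add: \<omega>_def w_def \<alpha>_def orth_proj_id[OF E])
    have inU: "(v, \<alpha>, b) \<in> U" using good by (simp add: good_def \<alpha>_def)
    from Wprops(5)[OF inU v] have \<omega>: "\<omega> \<in> avg_orth E"
      and eq: "F (v + \<omega>) \<alpha> b - orth_proj E (F (v + \<omega>) \<alpha> b) = 0"
      by (simp_all only: W_eq)
    have a: "0 \<le> norm v" "norm v \<le> 1" and \<beta>: "0 \<le> norm b" "norm b \<le> 1"
      using good by (simp_all add: good_def)
    have \<alpha>_diff: "\<bar>\<alpha> - \<alpha>c\<bar> \<le> 1" "\<bar>\<alpha> - \<alpha>c\<bar> * B \<le> c / 4" "\<alpha> - \<alpha>c = \<mu> / l" "(\<alpha> - \<alpha>c) * l = \<mu>"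
      using good l by (simp_all add: good_def \<alpha>_def)
    have \<alpha>_le: "\<bar>\<alpha>\<bar> \<le> \<alpha>c + 1" using \<alpha>_diff(1) \<alpha>c(2) by linarith
    define x where "x = \<alpha> *\<^sub>R (A *v (v + \<omega>)) + b"
    define g where "g = (\<chi> j. S (x $ j)) - x"
    \<comment> \<open>p is the leading part of x, linear in v; q is the correction, which turns out
      to be of size \<open>\<tau>\<close>, the sum of \<open>norm v ^ 3\<close> and
      \<open>norm b\<close>.\<close>
    define p where "p = \<alpha> *\<^sub>R (A *v v)"
    define q where "q = \<alpha> *\<^sub>R (A *v \<omega>) + b"
    have x_pq: "x = p + q" by (simp add: x_def p_def q_def matrix_vector_right_distrib algebra_simps)
    have \<alpha>A: "norm (\<alpha> *\<^sub>R (A *v u)) \<le> L * norm u" for u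
    proof -
      have "norm (\<alpha> *\<^sub>R (A *v u)) \<le> (\<alpha>c + 1) * (B * norm u)"
        using \<alpha>_le B(2)[of u] by (auto intro!: mult_mono)
      moreover have "L * norm u = (\<alpha>c + 1) * (B * norm u) + norm u"
        by (simp add: L_def algebra_simps)
      ultimately show ?thesis using norm_ge_zero[of u] by argo
    qed
    have p_le: "norm p \<le> L * norm v" unfolding p_def by (rule \<alpha>A)
    have q_le: "norm q \<le> L * (norm \<omega> + norm b)"
    proof -
      have "norm q \<le> L * norm \<omega> + 1 * norm b"
        unfolding q_def using norm_triangle_ineq[of "\<alpha> *\<^sub>R (A *v \<omega>)" b] \<alpha>A[of \<omega>] by simp
      also have "1 * norm b \<le> L * norm b" using L by (intro mult_right_mono) auto
      finally show ?thesis by (simp add: algebra_simps)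
    qed
    have x_le: "norm x \<le> L * (norm v + norm \<omega> + norm b)"
      using p_le q_le norm_triangle_ineq[of p q] by (simp add: x_pq algebra_simps)
    have x_small: "norm x \<le> \<delta> / 2" "norm x \<le> 1"
      using x_le good by (simp_all add: good_def \<omega>_def)
    define r where "r = g - s *\<^sub>R x ^ 3"
    have r_le: "norm r \<le> M * norm x ^ 5"
      unfolding r_def g_def by (rule componentwise_expansion[OF S_exp M x_small(1)])
    have x3_le: "norm (x ^ 3) \<le> norm x ^ 3" using norm_power_vec_le[of x 2] by (simp add: numeral_3_eq_3)
    have g_le: "norm g \<le> N0 * (norm v + norm \<omega> + norm b) ^ 3"
    proof -
      \<comment> \<open>As x has norm at most 1, the fifth power is absorbed into the cube.\<close>
      have "M * norm x ^ 5 \<le> M * norm x ^ 3"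
        using M x_small power_decreasing[of 3 5 "norm x"] by (intro mult_left_mono) auto
      moreover have "norm (s *\<^sub>R x ^ 3) \<le> \<bar>s\<bar> * norm x ^ 3"
        using x3_le by (simp add: mult_left_mono)
      moreover have "norm g \<le> norm (s *\<^sub>R x ^ 3) + norm r"
        using norm_triangle_ineq[of "s *\<^sub>R x ^ 3" r] by (simp add: r_def)
      ultimately have "norm g \<le> (\<bar>s\<bar> + M) * norm x ^ 3" using r_le by (simp add: algebra_simps)
      also have "\<dots> \<le> (\<bar>s\<bar> + M) * (L * (norm v + norm \<omega> + norm b)) ^ 3"
        using M x_le by (intro mult_left_mono power_mono) auto
      finally show ?thesis by (simp only: N0_def power_mult_distrib mult.assoc)
    qed
    note ce = lyapunov_schmidt_equations[OF E AE AE' v \<omega> \<alpha>c(1) \<alpha>_diff(4) x_def g_def]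
    have "c * norm \<omega> \<le> norm ((\<alpha> - \<alpha>c) *\<^sub>R (A *v \<omega>) + (b - orth_proj E b) + (g - orth_proj E g))"
      using c(2)[OF \<omega>] ce(2) eq by (simp only: F_def)
    also have "\<dots> \<le> c / 4 * norm \<omega> + norm b + norm g"
    proof -
      have "norm ((\<alpha> - \<alpha>c) *\<^sub>R (A *v \<omega>)) \<le> \<bar>\<alpha> - \<alpha>c\<bar> * (B * norm \<omega>)"
        using B(2)[of \<omega>] by (simp add: mult_left_mono)
      also have "\<dots> \<le> c / 4 * norm \<omega>"
        using mult_right_mono[OF \<alpha>_diff(2), of "norm \<omega>"] by (simp add: algebra_simps)
      finally show ?thesis
        using Q_le[of b] Q_le[of g] by (intro norm_triangle_le add_mono) auto
    qed
    also have "\<dots> \<le> c / 4 * norm \<omega> + norm b + N0 * (norm v + norm \<omega> + norm b) ^ 3"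
      using g_le by simp
    finally have \<omega>_le: "norm \<omega> \<le> C1 * (norm v ^ 3 + norm b)"
      unfolding C1_def using a \<beta> N0 c(1) good
      by (intro complement_size_bound) (auto simp: good_def \<omega>_def)
    define \<tau> where "\<tau> = norm v ^ 3 + norm b"
    have \<tau>: "0 \<le> \<tau>" by (simp add: \<tau>_def)
    have q_le': "norm q \<le> D * \<tau>"
    proof -
      have "norm \<omega> + norm b \<le> (C1 + 1) * \<tau>"
      proof -
        have "norm \<omega> \<le> C1 * \<tau>" using \<omega>_le by (simp only: \<tau>_def)
        moreover have "norm b \<le> \<tau>" by (simp add: \<tau>_def)
        ultimately show ?thesis unfolding distrib_right by simp
      qed
      then have "L * (norm \<omega> + norm b) \<le> L * ((C1 + 1) * \<tau>)"
        using L by (intro mult_left_mono) auto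
      then show ?thesis using q_le by (simp add: D_def mult.assoc)
    qed
    have p_le': "norm p \<le> D * norm v"
      using p_le mult_right_mono[OF D(1), of "norm v"] by simp
    have pq_le: "norm p + norm q \<le> D * (norm v + \<tau>)"
      using p_le' q_le' by (simp add: algebra_simps)
    have wb1: "\<tau> * (norm v + \<tau>) ^ 2 \<le> 8 * wt v \<mu> b" and wb2: "(norm v + \<tau>) ^ 5 \<le> 243 * wt v \<mu> b"
      using weight_bounds[OF a \<beta>, of "\<bar>\<mu>\<bar>"] by (simp_all add: wt_def \<tau>_def)
    have wt_ge: "\<bar>\<mu>\<bar> * norm v ^ 3 \<le> wt v \<mu> b" "norm b * norm v ^ 2 \<le> wt v \<mu> b" "0 \<le> wt v \<mu> b"
      by (simp_all add: wt_def add_increasing add_increasing2)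

    \<comment> \<open>The error of replacing x by p in the cubic term; 24 is 3 from
      \<open>norm_cube_diff_le\<close> times 8 from \<open>wb1\<close>.\<close>
    have t1: "norm (x ^ 3 - p ^ 3) \<le> 24 * D ^ 3 * wt v \<mu> b"
    proof -
      have "norm (x ^ 3 - p ^ 3) \<le> 3 * norm q * (norm p + norm q) ^ 2"
        unfolding x_pq by (rule norm_cube_diff_le)
      also have "\<dots> \<le> 3 * (D * \<tau>) * (D * (norm v + \<tau>)) ^ 2"
        using q_le' pq_le \<tau> D by (intro mult_mono power_mono mult_left_mono) auto
      also have "\<dots> = 3 * D ^ 3 * (\<tau> * (norm v + \<tau>) ^ 2)"
        by (simp add: power_mult_distrib power2_eq_square power3_eq_cube)
      also have "\<dots> \<le> 3 * D ^ 3 * (8 * wt v \<mu> b)"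
        using wb1 D by (intro mult_left_mono) auto
      finally show ?thesis by simp
    qed
    \<comment> \<open>Freezing \<open>\<alpha>\<close> at \<open>\<alpha>c\<close> in the cubic
      coefficient costs a factor \<open>\<mu> / l\<close>, which accounts for the weight
      \<open>\<bar>\<mu>\<bar> * norm v ^ 3\<close>.\<close>
    have t2: "norm ((\<alpha> ^ 3 - \<alpha>c ^ 3) *\<^sub>R (A *v v) ^ 3) \<le> 3 * (\<alpha>c + 1) ^ 2 / l * B ^ 3 * wt v \<mu> b"
    proof -
      have "\<bar>\<alpha> ^ 3 - \<alpha>c ^ 3\<bar> \<le> \<bar>\<mu>\<bar> / l * (3 * (\<alpha>c + 1) ^ 2)"
      proof -
        have "\<alpha> ^ 3 - \<alpha>c ^ 3 = \<mu> / l * (\<alpha> ^ 2 + \<alpha> * \<alpha>c + \<alpha>c ^ 2)"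
          unfolding \<alpha>_diff(3)[symmetric] by (simp add: power3_eq_cube power2_eq_square algebra_simps)
        moreover have "\<bar>\<alpha> ^ 2 + \<alpha> * \<alpha>c + \<alpha>c ^ 2\<bar> \<le> 3 * (\<alpha>c + 1) ^ 2"
        proof -
          have "\<bar>\<alpha> ^ 2\<bar> \<le> (\<alpha>c + 1) ^ 2"
            using power_mono[OF \<alpha>_le abs_ge_zero, of 2] by simp
          moreover have "\<bar>\<alpha> * \<alpha>c\<bar> \<le> (\<alpha>c + 1) ^ 2"
            unfolding abs_mult power2_eq_square using \<alpha>_le \<alpha>c(2) by (intro mult_mono) auto
          moreover have "\<bar>\<alpha>c ^ 2\<bar> \<le> (\<alpha>c + 1) ^ 2"
            using power_mono[of \<alpha>c "\<alpha>c + 1" 2] \<alpha>c(2) by simp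
          ultimately show ?thesis by argo
        qed
        ultimately show ?thesis using l by (simp add: abs_mult divide_right_mono mult_left_mono)
      qed
      moreover have "norm ((A *v v) ^ 3) \<le> B ^ 3 * norm v ^ 3"
      proof -
        have "norm ((A *v v) ^ 3) \<le> norm (A *v v) ^ 3"
          using norm_power_vec_le[of "A *v v" 2] by (simp add: numeral_3_eq_3)
        also have "\<dots> \<le> (B * norm v) ^ 3" using B by (intro power_mono) auto
        finally show ?thesis by (simp add: power_mult_distrib)
      qed
      ultimately have "norm ((\<alpha> ^ 3 - \<alpha>c ^ 3) *\<^sub>R (A *v v) ^ 3)
          \<le> (\<bar>\<mu>\<bar> / l * (3 * (\<alpha>c + 1) ^ 2)) * (B ^ 3 * norm v ^ 3)"
        using l by (simp only: norm_scaleR) (intro mult_mono, auto)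
      also have "\<dots> = 3 * (\<alpha>c + 1) ^ 2 / l * B ^ 3 * (\<bar>\<mu>\<bar> * norm v ^ 3)"
        by simp
      also have "\<dots> \<le> 3 * (\<alpha>c + 1) ^ 2 / l * B ^ 3 * wt v \<mu> b"
        using wt_ge(1) l B by (intro mult_left_mono) auto
      finally show ?thesis .
    qed
    have t3: "norm r \<le> M * (243 * D ^ 5) * wt v \<mu> b"
    proof -
      have "norm x ^ 5 \<le> (D * (norm v + \<tau>)) ^ 5"
        using pq_le norm_triangle_ineq[of p q] by (intro power_mono) (auto simp: x_pq)
      also have "\<dots> \<le> D ^ 5 * (243 * wt v \<mu> b)"
        unfolding power_mult_distrib using wb2 D by (intro mult_left_mono) auto
      finally have "M * norm x ^ 5 \<le> M * (D ^ 5 * (243 * wt v \<mu> b))" using M by (rule mult_left_mono)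
      then show ?thesis using r_le by (simp add: algebra_simps)
    qed
    \<comment> \<open>The displayed term with b is itself within the weight
      \<open>norm b * norm v ^ 2\<close>, so its difference from the true contribution is estimated
      by bounding it directly.\<close>
    have t4: "norm ((A *v v) ^ 2 * b) \<le> B ^ 2 * wt v \<mu> b"
    proof -
      have "norm ((A *v v) ^ 2 * b) \<le> norm ((A *v v) ^ 2) * norm b" by (rule norm_times_vec_le)
      also have "\<dots> \<le> (B * norm v) ^ 2 * norm b"
      proof (rule mult_right_mono)
        have "norm ((A *v v) ^ 2) \<le> norm (A *v v) ^ 2"
          using norm_power_vec_le[of "A *v v" 1] by (simp add: numeral_2_eq_2)
        also have "\<dots> \<le> (B * norm v) ^ 2" using B by (intro power_mono) auto
        finally show "norm ((A *v v) ^ 2) \<le> (B * norm v) ^ 2" .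
      qed simp
      also have "\<dots> = B ^ 2 * (norm b * norm v ^ 2)" by (simp add: power_mult_distrib)
      also have "\<dots> \<le> B ^ 2 * wt v \<mu> b" using wt_ge(2) by (intro mult_left_mono) auto
      finally show ?thesis .
    qed
    \<comment> \<open>The cube of x is split as its difference from \<open>p ^ 3\<close>, the change
      of \<open>p ^ 3\<close> from \<open>\<alpha>\<close> to \<open>\<alpha>c\<close>, and the main
      cubic term, which cancels in \<open>Rest\<close>.\<close>
    have Rest_eq: "Rest v \<mu> b = s *\<^sub>R orth_proj E (x ^ 3 - p ^ 3)
        + s *\<^sub>R orth_proj E ((\<alpha> ^ 3 - \<alpha>c ^ 3) *\<^sub>R (A *v v) ^ 3) + orth_proj E r
        - (s3 / 2 * \<alpha>c ^ 2) *\<^sub>R orth_proj E ((A *v v) ^ 2 * b)"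
    proof -
      have "reduced_map E F \<alpha>c l W v \<mu> b = \<mu> *\<^sub>R v + orth_proj E b + orth_proj E g"
        using ce(1) unfolding reduced_map_def F_def \<alpha>_def[symmetric] W_eq .
      moreover have "g = s *\<^sub>R (x ^ 3 - p ^ 3) + s *\<^sub>R ((\<alpha> ^ 3 - \<alpha>c ^ 3) *\<^sub>R (A *v v) ^ 3)
          + (s * \<alpha>c ^ 3) *\<^sub>R (A *v v) ^ 3 + r"
        by (simp add: r_def p_def scaleR_power_vec algebra_simps)
      then have "orth_proj E g = s *\<^sub>R orth_proj E (x ^ 3 - p ^ 3)
          + s *\<^sub>R orth_proj E ((\<alpha> ^ 3 - \<alpha>c ^ 3) *\<^sub>R (A *v v) ^ 3)
          + (s * \<alpha>c ^ 3) *\<^sub>R orth_proj E ((A *v v) ^ 3) + orth_proj E r"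
        by (simp only: P.add P.scale)
      ultimately show ?thesis by (simp add: Rest_def s_def)
    qed
    have "norm (Rest v \<mu> b) \<le> \<bar>s\<bar> * norm (x ^ 3 - p ^ 3)
        + \<bar>s\<bar> * norm ((\<alpha> ^ 3 - \<alpha>c ^ 3) *\<^sub>R (A *v v) ^ 3) + norm r
        + \<bar>s3 / 2 * \<alpha>c ^ 2\<bar> * norm ((A *v v) ^ 2 * b)"
      unfolding Rest_eq
      by (intro order_trans[OF norm_triangle_ineq4] order_trans[OF norm_triangle_ineq] add_mono
          scaled_P_le P_le)
    also have "\<dots> \<le> \<bar>s\<bar> * (24 * D ^ 3 * wt v \<mu> b)
        + \<bar>s\<bar> * (3 * (\<alpha>c + 1) ^ 2 / l * B ^ 3 * wt v \<mu> b) + M * (243 * D ^ 5) * wt v \<mu> b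
        + \<bar>s3 / 2 * \<alpha>c ^ 2\<bar> * (B ^ 2 * wt v \<mu> b)"
      by (intro add_mono mult_left_mono t1 t2 t3 t4 abs_ge_zero)
    also have "\<dots> = C * wt v \<mu> b" by (simp add: C_def distrib_right)
    finally show ?thesis .
  qed

  \<comment> \<open>Each of the five remainders is the share of \<open>Rest\<close> proportional to
    its weight.\<close>
  let ?R = "\<lambda>t v \<mu> b. (t v \<mu> b / wt v \<mu> b) *\<^sub>R Rest v \<mu> b"
  have wt0: "0 \<le> wt v \<mu> b" for v \<mu> b by (simp add: wt_def)
  have part: "norm ((t / wt v \<mu> b) *\<^sub>R Rest v \<mu> b) \<le> C * t"
    if "(v, \<mu>, b) \<in> N" "v \<in> E" "0 \<le> t" for t v \<mu> b
    using norm_proportional_part_le[OF Rest[OF N(3)]] that wt0 C by blast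
  show ?thesis
  proof (rule exI[of _ N], rule exI[of _ C],
      rule exI[of _ "?R (\<lambda>v \<mu> b. norm v ^ 5)"], rule exI[of _ "?R (\<lambda>v \<mu> b. \<bar>\<mu>\<bar> * norm v ^ 3)"],
      rule exI[of _ "?R (\<lambda>v \<mu> b. norm b * norm v ^ 2)"],
      rule exI[of _ "?R (\<lambda>v \<mu> b. norm b ^ 2 * norm v)"],
      rule exI[of _ "?R (\<lambda>v \<mu> b. norm b ^ 3)"], intro conjI allI impI)
    fix v \<mu> b assume N': "(v, \<mu>, b) \<in> N" and v: "v \<in> E"
    show "(v, \<alpha>c + \<mu> / l, b) \<in> U" using N(3)[OF N'] by (simp add: good_def)
    have "reduced_map E F \<alpha>c l W v \<mu> b = \<mu> *\<^sub>R v + orth_proj E b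
         + (s3 / 6 * \<alpha>c ^ 3) *\<^sub>R orth_proj E ((A *v v) ^ 3)
         + (s3 / 2 * \<alpha>c ^ 2) *\<^sub>R orth_proj E ((A *v v) ^ 2 * b) + Rest v \<mu> b"
      by (simp add: Rest_def)
    then show "reduced_map E F \<alpha>c l W v \<mu> b = \<mu> *\<^sub>R v + orth_proj E b
         + (s3 / 6 * \<alpha>c ^ 3) *\<^sub>R orth_proj E ((A *v v) ^ 3)
         + (s3 / 2 * \<alpha>c ^ 2) *\<^sub>R orth_proj E ((A *v v) ^ 2 * b)
         + (?R (\<lambda>v \<mu> b. norm v ^ 5) v \<mu> b + ?R (\<lambda>v \<mu> b. \<bar>\<mu>\<bar> * norm v ^ 3) v \<mu> b
          + ?R (\<lambda>v \<mu> b. norm b * norm v ^ 2) v \<mu> b + ?R (\<lambda>v \<mu> b. norm b ^ 2 * norm v) v \<mu> b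
          + ?R (\<lambda>v \<mu> b. norm b ^ 3) v \<mu> b)"
      using sum_proportional_parts[OF Rest[OF N(3)[OF N'] v, unfolded wt_def]]
      unfolding wt_def by (simp only:)
  qed (use N part in auto)
qed

end
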